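(* Let $n\ge 0$ be an integer and let $\sigma$ be a real number with $\sigma\ge n+2$ (so that both classes below are defined). Then $S_{n+1}^\sigma\subset S_n^\sigma$.
   Context: Let $E=\{z\in\mathbb{C}:|z|<1\}$ and let $A$ be the class of analytic functions on $E$ of the form $f(z)=z+\sum_{k\ge2}a_kz^k$. For an integer $n\ge0$ and a real number $\sigma$ with $\sigma-(n-1)>0$, the operator $L_n^\sigma:A\to A$ is defined by $$L_n^\sigma f(z)=z+\sum_{k=2}^\infty\left\{\prod_{j=0}^{n-1}\frac{\sigma+k-1-j}{\sigma-j}\right\}a_kz^k$$ (the empty product is $1$, so $L_0^\sigma f=f$). For an integer $m\ge0$ and real $\sigma\ge m+1$, a function $f\in A$ belongs to the class $S_m^\sigma$ if and only if $$\mathrm{Re}\,\frac{L_{m+1}^\sigma f(z)}{L_m^\sigma f(z)}>\frac{\sigma-(m+1)}{\sigma-m},\qquad z\in E,$$ where the quotient at $z=0$ is understood as its limit $1$. *)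

theory Defs
  imports "HOL-Complex_Analysis.Complex_Analysis"
begin

abbreviation unit_disc :: "complex set" where
  "unit_disc \<equiv> ball 0 1"

abbreviation taylor_coeff :: "(complex \<Rightarrow> complex) \<Rightarrow> nat \<Rightarrow> complex" where
  "taylor_coeff f k \<equiv> fps_nth (fps_expansion f 0) k"

(* Functions are total on the complex plane, but only their values on the unit disc matter.
   The power series z + a_2 z^2 + a_3 z^3 + ... is written with its index shifted by 2. *)
definition class_A :: "(complex \<Rightarrow> complex) set" where
  "class_A = {f. f holomorphic_on unit_disc \<and>
     (\<forall>z\<in>unit_disc. (\<lambda>k. taylor_coeff f (k + 2) * z ^ (k + 2)) sums (f z - z))}"

(* Intended for \<sigma> > n - 1, so that no denominator vanishes, and for f in class_A and |z| < 1,
   so that the series converges. *)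
definition L_op :: "nat \<Rightarrow> real \<Rightarrow> (complex \<Rightarrow> complex) \<Rightarrow> complex \<Rightarrow> complex" where
  "L_op n \<sigma> f z =
     z + (\<Sum>k. complex_of_real (\<Prod>j<n. (\<sigma> + real (k + 2) - 1 - real j) / (\<sigma> - real j))
               * taylor_coeff f (k + 2) * z ^ (k + 2))"

(* Intended for \<sigma> \<ge> m + 1. The bound is then nonnegative, so with the convention x / 0 = 0
   the strict inequality fails wherever L_op m \<sigma> f vanishes at some z \<noteq> 0: membership entails
   that the quotient is a genuine one throughout the punctured disc. *)
definition class_S :: "nat \<Rightarrow> real \<Rightarrow> (complex \<Rightarrow> complex) set" where
  "class_S m \<sigma> = {f \<in> class_A. \<forall>z\<in>unit_disc.
     Re (if z = 0 then 1 else L_op (m + 1) \<sigma> f z / L_op m \<sigma> f z)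
       > (\<sigma> - (real m + 1)) / (\<sigma> - real m)}"

end

theory Submission
  imports Defs
begin

text \<open>
  With \<open>s = \<sigma> - n\<close>, the \<open>k\<close>-th coefficients of \<open>L\<^sub>n f\<close> and \<open>L\<^sub>n\<^sub>+\<^sub>1 f\<close> differ by the
  factor \<open>(s + k - 1) / s\<close>, which amounts to a first-order differential operator:
  \<open>z (L\<^sub>n f)' = s L\<^sub>n\<^sub>+\<^sub>1 f - (s - 1) L\<^sub>n f\<close>. So membership in the class of index \<open>n\<close> says precisely
  that \<open>L\<^sub>n f\<close> is starlike, and \<open>L\<^sub>n f\<close> is the Bernardi integral transform of \<open>L\<^sub>n\<^sub>+\<^sub>1 f\<close>; the
  theorem says that this transform preserves starlikeness.

  The usual argument looks at \<open>p = z (L\<^sub>n f)' / L\<^sub>n f\<close>, which could have poles. Here the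
  reciprocal quotient \<open>h = L\<^sub>n f / L\<^sub>n\<^sub>+\<^sub>1 f\<close> is used instead: the hypothesis makes its denominator
  free of zeros except for the simple one at the origin, so \<open>h\<close> is holomorphic with \<open>h 0 = 1\<close>.
  Put \<open>c = s - 1\<close>. The two differential relations, for \<open>n\<close> and \<open>n + 1\<close>, combine into
  \<open>z h' + Q h = c + 1\<close> with \<open>Q = 1 + c L\<^sub>n\<^sub>+\<^sub>2 f / L\<^sub>n\<^sub>+\<^sub>1 f\<close>, and the hypothesis becomes
  \<open>Re Q > c\<close>. The conclusion \<open>Re (1 / h) > c / (c + 1)\<close> says that \<open>h\<close> stays in the disc of centre
  and radius \<open>\<rho> = (c + 1) / (2 c)\<close>, whose boundary passes through \<open>0\<close>
  (\<open>Re_inverse_circle_through_0\<close>).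

  Suppose \<open>h\<close> leaves this disc, for the first time at a point \<open>a\<close> of least modulus. By Jack's
  lemma (\<open>boundary_maximum_derivative\<close>), \<open>a h'(a) = k (h(a) - \<rho>)\<close> with \<open>k \<ge> 0\<close>: the image
  moves straight outwards. Inserting this and \<open>Re (1 / h(a)) = 1 / (2 \<rho>)\<close> into the equation gives
  \<open>Re (Q a) = c - k / 2 \<le> c\<close>, a contradiction (\<open>disc_invariant_under_ode\<close>).
\<close>

section \<open>Leaving a disc for the first time\<close>

text \<open>
  The weak form of Jack's lemma, without a lower bound for \<open>k\<close>. Moving from \<open>a\<close> in any direction
  that points into the disc \<open>|z| < |a|\<close> cannot increase the component of \<open>w\<close> along \<open>w a\<close>. These
  directions fill a half-plane, which forces the number \<open>a w' / w a\<close> to be real and nonnegative.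
\<close>
lemma boundary_maximum_derivative:
  fixes w :: "complex \<Rightarrow> complex"
  assumes deriv: "(w has_field_derivative w') (at a)"
    and maximal: "\<And>z. cmod z < cmod a \<Longrightarrow> cmod (w z) \<le> cmod (w a)"
    and nz: "a \<noteq> 0" "w a \<noteq> 0"
  obtains k :: real where "k \<ge> 0" "a * w' = of_real k * w a"
proof -
  define A where "A = a * w' * cnj (w a)"
  (* The inward directions are, up to positive factors, - a * Complex 1 y. *)
  have half_plane: "Re (Complex 1 y * A) \<ge> 0" for y :: real
  proof (rule ccontr)
    define \<eta> where "\<eta> = Complex 1 y"
    define \<psi> where "\<psi> t = Re (w (a * (1 - of_real t * \<eta>)) * cnj (w a))" for t :: real
    assume "\<not> Re (Complex 1 y * A) \<ge> 0"
    then have "- Re (\<eta> * A) > 0" by (simp add: \<eta>_def)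
    moreover have "(\<psi> has_real_derivative - Re (\<eta> * A)) (at 0)"
    proof -
      have w: "(w has_field_derivative w') (at (a * (1 - of_real 0 * \<eta>)))"
        using deriv by simp
      have "((\<lambda>z. w (a * (1 - z * \<eta>))) has_field_derivative w' * (- (a * \<eta>))) (at (of_real 0))"
        using w by (rule DERIV_chain2[where f = w and g = "\<lambda>z. a * (1 - z * \<eta>)"])
          (auto intro!: derivative_eq_intros)
      then have "((\<lambda>z. w (a * (1 - z * \<eta>)) * cnj (w a)) has_field_derivative
                   w' * (- (a * \<eta>)) * cnj (w a)) (at (of_real 0))"
        by (rule DERIV_cmult_right)
      then have "((\<lambda>t. w (a * (1 - of_real t * \<eta>)) * cnj (w a)) has_vector_derivative
                   w' * (- (a * \<eta>)) * cnj (w a)) (at 0)"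
        by (rule has_vector_derivative_real_field)
      then have "((\<lambda>t. Re (w (a * (1 - of_real t * \<eta>)) * cnj (w a))) has_vector_derivative
                   Re (w' * (- (a * \<eta>)) * cnj (w a))) (at 0)"
        by (rule bounded_linear.has_vector_derivative[OF bounded_linear_Re])
      moreover have "Re (w' * (- (a * \<eta>)) * cnj (w a)) = - Re (\<eta> * A)"
        by (simp add: A_def algebra_simps)
      ultimately show ?thesis
        by (simp add: has_real_derivative_iff_has_vector_derivative \<psi>_def[abs_def])
    qed
    ultimately obtain d where d: "d > 0" "\<And>h. 0 < h \<Longrightarrow> h < d \<Longrightarrow> \<psi> 0 < \<psi> (0 + h)"
      using DERIV_pos_inc_right by blast
    define t where "t = min (d / 2) (1 / (1 + y\<^sup>2))"
    have pos: "1 + y\<^sup>2 > 0" by (simp add: add_pos_nonneg)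
    have t: "0 < t" "t < d" "t * (1 + y\<^sup>2) \<le> 1"
      using d(1) pos by (auto simp: t_def min_def field_simps)
    have "(cmod (1 - of_real t * \<eta>))\<^sup>2 = 1 - 2 * t + t * (t * (1 + y\<^sup>2))"
      unfolding cmod_power2 by (simp add: \<eta>_def power2_eq_square algebra_simps)
    also have "\<dots> \<le> 1 - 2 * t + t * 1"
      using t by (intro add_left_mono mult_left_mono) auto
    also have "\<dots> < 1\<^sup>2" using t by simp
    finally have "cmod (1 - of_real t * \<eta>) < 1"
      by (rule power_less_imp_less_base) simp
    then have "cmod (a * (1 - of_real t * \<eta>)) < cmod a"
      using nz by (simp add: norm_mult)
    then have "cmod (w (a * (1 - of_real t * \<eta>))) \<le> cmod (w a)" by (rule maximal)
    then have "cmod (w (a * (1 - of_real t * \<eta>)) * cnj (w a)) \<le> cmod (w a) * cmod (w a)"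
      by (simp add: norm_mult mult_right_mono)
    then have "\<psi> t \<le> cmod (w a) * cmod (w a)"
      unfolding \<psi>_def using complex_Re_le_cmod order_trans by blast
    also have "\<dots> = \<psi> 0" unfolding \<psi>_def
      by (simp add: cmod_def flip: power2_eq_square)
    finally show False using d(2)[of t] t by simp
  qed
  (* The inequality reads Re A - y * Im A >= 0; this y would make the left side -1. *)
  have "Im A = 0"
  proof (rule ccontr)
    assume "Im A \<noteq> 0"
    then show False using half_plane[of "(Re A + 1) / Im A"] by simp
  qed
  moreover have "Re A \<ge> 0" using half_plane[of 0] by simp
  ultimately have A: "A = of_real (Re A)" "Re A \<ge> 0" by (simp_all add: complex_eq_iff)
  have "a * w' * (cnj (w a) * w a) = of_real (Re A) * w a"
    using A(1) unfolding A_def by (metis mult.assoc)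
  also have "cnj (w a) * w a = of_real ((cmod (w a))\<^sup>2)"
    by (metis complex_norm_square mult.commute of_real_power)
  finally have "a * w' = of_real (Re A / (cmod (w a))\<^sup>2) * w a"
    using nz by (simp add: field_simps)
  then show thesis using A(2) by (intro that[of "Re A / (cmod (w a))\<^sup>2"]) auto
qed

text \<open>
  Inversion maps the circle of centre and radius \<open>\<rho>\<close>, which passes through \<open>0\<close>, to a vertical
  line.
\<close>
lemma Re_inverse_circle_through_0:
  fixes h :: complex and \<rho> :: real
  assumes "\<rho> > 0" "h \<noteq> 0"
  shows "Re (inverse h) > 1 / (2 * \<rho>) \<longleftrightarrow> cmod (h - of_real \<rho>) < \<rho>"
    and "Re (inverse h) = 1 / (2 * \<rho>) \<longleftrightarrow> cmod (h - of_real \<rho>) = \<rho>"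
proof -
  have dist: "(cmod (h - of_real \<rho>))\<^sup>2 - \<rho>\<^sup>2 = (cmod h)\<^sup>2 - 2 * \<rho> * Re h"
    unfolding cmod_power2 by (simp add: power2_eq_square algebra_simps)
  have h: "(cmod h)\<^sup>2 > 0" "Re (inverse h) = Re h / (cmod h)\<^sup>2"
    using assms by (simp, simp add: cmod_power2)
  have "1 / (2 * \<rho>) < x / N \<longleftrightarrow> N < 2 * \<rho> * x" "x / N = 1 / (2 * \<rho>) \<longleftrightarrow> N = 2 * \<rho> * x"
    if "N > 0" for x N :: real
    using that assms(1) by (auto simp: field_simps)
  note inv = this[OF h(1), of "Re h", folded h(2)]
  have "cmod (h - of_real \<rho>) < \<rho> \<longleftrightarrow> (cmod (h - of_real \<rho>))\<^sup>2 < \<rho>\<^sup>2"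
    using assms by (simp add: power_mono_iff flip: not_le)
  then show "Re (inverse h) > 1 / (2 * \<rho>) \<longleftrightarrow> cmod (h - of_real \<rho>) < \<rho>"
    unfolding inv using dist by linarith
  have "cmod (h - of_real \<rho>) = \<rho> \<longleftrightarrow> (cmod (h - of_real \<rho>))\<^sup>2 = \<rho>\<^sup>2"
    using assms by simp
  then show "Re (inverse h) = 1 / (2 * \<rho>) \<longleftrightarrow> cmod (h - of_real \<rho>) = \<rho>"
    unfolding inv using dist by linarith
qed

lemma first_exit_point:
  fixes w :: "complex \<Rightarrow> complex"
  assumes cont: "continuous_on (ball 0 R) w"
    and start: "cmod (w 0) < \<rho>" and "z \<in> ball 0 R" and exit: "cmod (w z) \<ge> \<rho>"
  obtains a where "a \<in> ball 0 R" "a \<noteq> 0" "cmod (w a) = \<rho>"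
    "\<And>z. cmod z < cmod a \<Longrightarrow> cmod (w z) < \<rho>"
proof -
  define K where "K = {x \<in> cball 0 (cmod z). cmod (w x) \<in> {\<rho>..}}"
  have sub: "cball 0 (cmod z) \<subseteq> ball 0 R" using assms(3) by auto
  have contK: "continuous_on (cball 0 (cmod z)) (\<lambda>x. cmod (w x))"
    by (intro continuous_on_norm continuous_on_subset[OF cont sub])
  have "closed K" unfolding K_def
    using continuous_closed_preimage[OF contK, of "{\<rho>..}"] by (simp add: vimage_def Int_def)
  moreover have "z \<in> K" using exit by (simp add: K_def)
  ultimately obtain a where a: "a \<in> K" "\<And>y. y \<in> K \<Longrightarrow> dist 0 a \<le> dist 0 y"
    using distance_attains_inf[of K 0] by blast
  have az: "cmod a \<le> cmod z" and ge: "cmod (w a) \<ge> \<rho>" using a(1) by (auto simp: K_def)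
  have inside: "cmod (w x) < \<rho>" if "cmod x < cmod a" for x
    using a(2)[of x] that az by (force simp: K_def)
  have a0: "a \<noteq> 0" using ge start by auto
  have "cmod (w a) \<le> \<rho>"
  proof (rule tendsto_upperbound)
    have "isCont w a"
      using cont az assms(3) by (auto simp: continuous_on_eq_continuous_at)
    moreover have "((\<lambda>t. complex_of_real t * a) \<longlongrightarrow> of_real 1 * a) (at_left 1)"
      by (intro tendsto_intros)
    ultimately show "((\<lambda>t. cmod (w (of_real t * a))) \<longlongrightarrow> cmod (w a)) (at_left 1)"
      by (intro tendsto_norm isCont_tendsto_compose[where g = w]) simp_all
    have "\<forall>\<^sub>F t in at_left (1::real). t \<in> {0<..<1}"
      by (rule eventually_at_left_real) simp
    then show "\<forall>\<^sub>F t in at_left 1. cmod (w (of_real t * a)) \<le> \<rho>"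
      by eventually_elim (use a0 in \<open>auto intro!: less_imp_le inside simp: norm_mult\<close>)
  qed simp
  with ge a0 inside az assms(3) show thesis by (intro that[of a]) auto
qed

section \<open>The differential equation\<close>

text \<open>
  At a first exit point \<open>a\<close>, Jack's lemma turns the equation into
  \<open>k (h(a) - \<rho>) + Q(a) h(a) = 2 c \<rho>\<close>. Dividing by \<open>h(a)\<close> and taking real parts on the circle
  through \<open>0\<close> gives \<open>Re (Q a) = c - k / 2\<close>.
\<close>
lemma disc_invariant_under_ode:
  fixes h h' Q :: "complex \<Rightarrow> complex" and c :: real
  assumes "c > 0"
    and deriv: "\<And>z. z \<in> ball 0 R \<Longrightarrow> (h has_field_derivative h' z) (at z)"
    and ode: "\<And>z. z \<in> ball 0 R \<Longrightarrow> z * h' z + Q z * h z = of_real (c + 1)"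
    and Q: "\<And>z. z \<in> ball 0 R \<Longrightarrow> Re (Q z) > c"
    and "h 0 = 1" and z: "z \<in> ball 0 R"
  shows "cmod (h z - of_real ((c + 1) / (2 * c))) < (c + 1) / (2 * c)"
proof (rule ccontr)
  define \<rho> where "\<rho> = (c + 1) / (2 * c)"
  define w where "w z = h z - of_real \<rho>" for z
  have \<rho>: "\<rho> > 1 / 2" "c + 1 = 2 * c * \<rho>" using \<open>c > 0\<close> by (simp_all add: \<rho>_def field_simps)
  have deriv_w: "(w has_field_derivative h' z) (at z)" if "z \<in> ball 0 R" for z
    unfolding w_def using deriv[OF that] by (auto intro!: derivative_eq_intros)
  (* The starting value 1 lies in the disc since |1 - \<rho>| < \<rho> for every \<rho> > 1/2. *)
  have "w 0 = of_real (1 - \<rho>)" by (simp add: w_def \<open>h 0 = 1\<close>)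
  then have start: "cmod (w 0) < \<rho>" using \<rho> by (simp only: norm_of_real)
  have cont: "continuous_on (ball 0 R) w"
    using deriv_w by (meson DERIV_isCont continuous_at_imp_continuous_on)
  assume "\<not> cmod (h z - of_real ((c + 1) / (2 * c))) < (c + 1) / (2 * c)"
  then have "cmod (w z) \<ge> \<rho>" by (simp add: w_def \<rho>_def)
  then obtain a where a: "a \<in> ball 0 R" "a \<noteq> 0" "cmod (w a) = \<rho>"
    and inside: "\<And>z. cmod z < cmod a \<Longrightarrow> cmod (w z) < \<rho>"
    using first_exit_point[OF cont start z] by blast
  have maximal: "cmod (w z) \<le> cmod (w a)" if "cmod z < cmod a" for z
    using inside[OF that] a(3) by simp
  have "w a \<noteq> 0" using a(3) \<rho> by auto
  then obtain k where k: "k \<ge> 0" "a * h' a = of_real k * w a"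
    using boundary_maximum_derivative[OF deriv_w[OF a(1)] maximal a(2)] by blast
  have w: "w a = h a - of_real \<rho>" by (simp add: w_def)
  have eq: "of_real k * (h a - of_real \<rho>) + Q a * h a = of_real (2 * c * \<rho>)"
    using ode[OF a(1)] unfolding k(2) \<rho>(2) w .
  show False
  proof (cases "h a = 0")
    case True
    with eq have "complex_of_real (- (k * \<rho>)) = of_real (2 * c * \<rho>)" by simp
    then have "- (k * \<rho>) = 2 * c * \<rho>" by (rule of_real_eq_iff[THEN iffD1])
    moreover have "k * \<rho> \<ge> 0" "c * \<rho> > 0" using k \<rho> \<open>c > 0\<close> by auto
    ultimately show False by linarith
  next
    case False
    then have "Q a = of_real (2 * c * \<rho> + k * \<rho>) * inverse (h a) - of_real k"
      using eq by (simp add: field_simps)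
    then have "Re (Q a) = (2 * c * \<rho> + k * \<rho>) * Re (inverse (h a)) - k" by simp
    also have "Re (inverse (h a)) = 1 / (2 * \<rho>)"
      using Re_inverse_circle_through_0(2)[of \<rho> "h a"] False a(3) \<rho> w by simp
    also have "(2 * c * \<rho> + k * \<rho>) * (1 / (2 * \<rho>)) - k = c - k / 2"
      using \<rho> by (simp add: field_simps)
    finally show False using Q[OF a(1)] k by simp
  qed
qed

text \<open>
  The quotient rule merges the two equations into one for \<open>h = u / v\<close>. The bound
  \<open>(c - 1) / c\<close> in the hypothesis is nonnegative, so by the convention \<open>x / 0 = 0\<close> it also says
  that \<open>v\<close> has no zeros.
\<close>
lemma ratio_in_half_plane:
  fixes u v w :: "complex \<Rightarrow> complex" and c :: real
  assumes "c \<ge> 1"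
    and u: "\<And>z. z \<in> ball 0 R \<Longrightarrow> (u has_field_derivative u' z) (at z)"
    and v: "\<And>z. z \<in> ball 0 R \<Longrightarrow> (v has_field_derivative v' z) (at z)"
    and u_eq: "\<And>z. z \<in> ball 0 R \<Longrightarrow> z * u' z = of_real (c + 1) * (v z - u z)"
    and v_eq: "\<And>z. z \<in> ball 0 R \<Longrightarrow> z * v' z = of_real c * (w z - v z)"
    and norm: "u 0 = 1" "v 0 = 1"
    and star: "\<And>z. z \<in> ball 0 R \<Longrightarrow> Re (w z / v z) > (c - 1) / c"
    and z: "z \<in> ball 0 R"
  shows "Re (v z / u z) > c / (c + 1)"
proof -
  have v0: "v z \<noteq> 0" if "z \<in> ball 0 R" for z
    using star[OF that] \<open>c \<ge> 1\<close> by (auto simp: field_simps)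
  define h where "h z = u z / v z" for z
  define h' where "h' z = (u' z * v z - u z * v' z) / (v z * v z)" for z
  define Q where "Q z = 1 + of_real c * (w z / v z)" for z
  define \<rho> where "\<rho> = (c + 1) / (2 * c)"
  have \<rho>: "\<rho> > 0" "c / (c + 1) = 1 / (2 * \<rho>)" using \<open>c \<ge> 1\<close> by (simp_all add: \<rho>_def field_simps)
  have "cmod (h z - of_real \<rho>) < \<rho>"
    unfolding \<rho>_def
  proof (rule disc_invariant_under_ode[where R = R and h = h and h' = h' and Q = Q])
    fix z :: complex assume z: "z \<in> ball 0 R"
    show "(h has_field_derivative h' z) (at z)"
      unfolding h_def[abs_def] h'_def using u[OF z] v[OF z] v0[OF z] by (rule DERIV_divide)
    have "z * h' z = (z * u' z) / v z - h z * ((z * v' z) / v z)"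
      using v0[OF z] by (simp add: h_def h'_def field_simps)
    also have "(z * u' z) / v z = of_real (c + 1) * (1 - h z)"
      using v0[OF z] by (simp only: u_eq[OF z]) (simp add: h_def field_simps)
    also have "(z * v' z) / v z = Q z - 1 - of_real c"
      using v0[OF z] by (simp only: v_eq[OF z]) (simp add: Q_def field_simps)
    finally show "z * h' z + Q z * h z = of_real (c + 1)" by (simp add: algebra_simps)
    show "Re (Q z) > c"
    proof -
      have "Re (Q z) = 1 + c * Re (w z / v z)"
        by (simp add: Q_def del: times_divide_eq_right)
      then show ?thesis using star[OF z] \<open>c \<ge> 1\<close> by (simp add: field_simps)
    qed
  qed (use \<open>c \<ge> 1\<close> norm z in \<open>auto simp: h_def\<close>)
  moreover from this have "h z \<noteq> 0" using \<rho> by auto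
  ultimately show ?thesis
    using Re_inverse_circle_through_0(1)[OF \<rho>(1), of "h z"] \<rho> by (simp add: h_def)
qed

section \<open>The operators as power series\<close>

text \<open>
  The power series of \<open>L\<^sub>n f z / z\<close>. Dividing by \<open>z\<close> removes the common zero of all the
  \<open>L\<^sub>n f\<close> at the origin, so that quotients of these series are holomorphic there. The constant
  coefficient is set to \<open>1\<close> because \<open>L\<^sub>n f\<close> starts with \<open>z\<close> whatever \<open>f\<close> is.
\<close>
definition L_quotient_fps :: "nat \<Rightarrow> real \<Rightarrow> (complex \<Rightarrow> complex) \<Rightarrow> complex fps" where
  "L_quotient_fps n \<sigma> f = Abs_fps (\<lambda>k.
     complex_of_real (\<Prod>j<n. (\<sigma> + real k - real j) / (\<sigma> - real j))
     * (if k = 0 then 1 else taylor_coeff f (k + 1)))"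

lemma L_quotient_fps_nth_0:
  assumes "\<sigma> > real n - 1"
  shows "fps_nth (L_quotient_fps n \<sigma> f) 0 = 1"
proof -
  have "(\<Prod>j<n. (\<sigma> + real 0 - real j) / (\<sigma> - real j)) = 1"
    using assms by (intro prod.neutral) auto
  then show ?thesis by (simp only: L_quotient_fps_def fps_nth_Abs_fps) simp
qed

text \<open>
  The product for \<open>n + 1\<close> has the one additional factor \<open>(\<sigma> + k - n) / (\<sigma> - n)\<close>, and
  \<open>fps_X * fps_deriv\<close> multiplies the \<open>k\<close>-th coefficient by \<open>k\<close>.
\<close>
lemma fps_X_deriv_L_quotient:
  assumes "\<sigma> > real n"
  shows "fps_X * fps_deriv (L_quotient_fps n \<sigma> f) =
    fps_const (of_real (\<sigma> - real n)) * (L_quotient_fps (Suc n) \<sigma> f - L_quotient_fps n \<sigma> f)"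
proof (rule fps_ext)
  fix k
  define P where "P m = (\<Prod>j<m. (\<sigma> + real k - real j) / (\<sigma> - real j))" for m
  define b where "b = (if k = 0 then 1 else taylor_coeff f (k + 1))"
  have nth: "fps_nth (L_quotient_fps m \<sigma> f) k = of_real (P m) * b" for m
    by (simp add: L_quotient_fps_def P_def b_def)
  have "(\<sigma> - real n) * (P (Suc n) - P n) = real k * P n"
    using assms by (simp add: P_def field_simps)
  from arg_cong[OF this, of complex_of_real]
  have "of_real (\<sigma> - real n) * (of_real (P (Suc n)) - of_real (P n)) = (of_nat k * of_real (P n) :: complex)"
    by (simp only: of_real_mult of_real_diff of_real_of_nat_eq)
  then have "of_real (\<sigma> - real n) * (of_real (P (Suc n)) * b - of_real (P n) * b) =
      of_nat k * (of_real (P n) * b)"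
    by (simp only: flip: left_diff_distrib mult.assoc)
  moreover have "fps_nth (fps_X * fps_deriv F) k = of_nat k * fps_nth F k" for F :: "complex fps"
    by (cases k) auto
  ultimately show "fps_nth (fps_X * fps_deriv (L_quotient_fps n \<sigma> f)) k =
    fps_nth (fps_const (of_real (\<sigma> - real n)) * (L_quotient_fps (Suc n) \<sigma> f - L_quotient_fps n \<sigma> f)) k"
    by (simp only: fps_mult_left_const_nth fps_sub_nth nth)
qed

text \<open>
  By the previous relation each series is obtained from its predecessor by differentiation and
  algebra, neither of which decreases the radius of convergence.
\<close>
lemma conv_radius_L_quotient:
  assumes "f holomorphic_on unit_disc" "\<sigma> > real n - 1"
  shows "fps_conv_radius (L_quotient_fps n \<sigma> f) \<ge> 1"
  using assms(2)
proof (induction n)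
  case 0
  have "conv_radius (\<lambda>k. fps_nth (L_quotient_fps 0 \<sigma> f) k) =
      conv_radius (\<lambda>k. fps_nth (fps_shift 1 (fps_expansion f 0)) k)"
    by (intro conv_radius_cong eventually_mono[OF eventually_gt_at_top[of 0]])
      (auto simp: L_quotient_fps_def)
  then have "fps_conv_radius (L_quotient_fps 0 \<sigma> f) = fps_conv_radius (fps_expansion f 0)"
    using fps_conv_radius_shift[of 1 "fps_expansion f 0"] by (simp add: fps_conv_radius_def)
  then show ?case
    using conv_radius_fps_expansion[of f 0 "ereal 1"] assms(1)
    by (simp only: eball_ereal) (simp flip: one_ereal_def)
next
  case (Suc n)
  let ?F = "L_quotient_fps n \<sigma> f" and ?s = "complex_of_real (\<sigma> - real n)"
  have s: "?s \<noteq> 0" using Suc.prems by (simp flip: of_real_diff)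
  have IH: "fps_conv_radius ?F \<ge> 1" using Suc by simp
  have step: "L_quotient_fps (Suc n) \<sigma> f = ?F + fps_const (inverse ?s) * (fps_X * fps_deriv ?F)"
    using Suc.prems s fps_X_deriv_L_quotient[of n \<sigma> f]
    by (simp flip: mult.assoc)
  have "1 \<le> fps_conv_radius (fps_X * fps_deriv ?F)"
    using fps_conv_radius_mult[of fps_X "fps_deriv ?F"] fps_conv_radius_deriv[of ?F] IH
    by (simp add: min_def split: if_splits)
  then have "1 \<le> fps_conv_radius (fps_const (inverse ?s) * (fps_X * fps_deriv ?F))"
    using s by (simp add: fps_conv_radius_cmult_left)
  with IH have "1 \<le> min (fps_conv_radius ?F)
      (fps_conv_radius (fps_const (inverse ?s) * (fps_X * fps_deriv ?F)))"
    by (rule min.boundedI)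
  then show ?case
    unfolding step using fps_conv_radius_add by (rule order_trans)
qed

lemma in_conv_radius_L_quotient:
  assumes hol: "f holomorphic_on unit_disc" and z: "z \<in> unit_disc" and \<sigma>: "\<sigma> > real n - 1"
  shows "ereal (norm z) < fps_conv_radius (L_quotient_fps n \<sigma> f)"
proof -
  have "ereal (norm z) < 1" using z by simp
  also have "1 \<le> fps_conv_radius (L_quotient_fps n \<sigma> f)"
    using hol \<sigma> by (rule conv_radius_L_quotient)
  finally show ?thesis .
qed

lemma L_op_eq_eval_L_quotient:
  assumes hol: "f holomorphic_on unit_disc" and z: "z \<in> unit_disc" and \<sigma>: "\<sigma> > real n - 1"
  shows "L_op n \<sigma> f z = z * eval_fps (L_quotient_fps n \<sigma> f) z"
proof -
  let ?F = "L_quotient_fps n \<sigma> f"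
  have "(\<lambda>k. fps_nth ?F k * z ^ k) sums eval_fps ?F z"
    by (intro sums_eval_fps in_conv_radius_L_quotient hol z \<sigma>)
  then have "(\<lambda>k. fps_nth ?F (Suc k) * z ^ Suc k) sums (eval_fps ?F z - 1)"
    using sums_Suc_iff[of "\<lambda>k. fps_nth ?F k * z ^ k" "eval_fps ?F z - 1"]
    by (simp add: L_quotient_fps_nth_0[OF \<sigma>])
  then have "(\<lambda>k. z * (fps_nth ?F (Suc k) * z ^ Suc k)) sums (z * (eval_fps ?F z - 1))"
    by (rule sums_mult)
  moreover have "z * (fps_nth ?F (Suc k) * z ^ Suc k) =
      complex_of_real (\<Prod>j<n. (\<sigma> + real (k + 2) - 1 - real j) / (\<sigma> - real j))
        * taylor_coeff f (k + 2) * z ^ (k + 2)" for k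
    by (simp add: L_quotient_fps_def algebra_simps)
  ultimately have "(\<Sum>k. complex_of_real (\<Prod>j<n. (\<sigma> + real (k + 2) - 1 - real j) / (\<sigma> - real j))
        * taylor_coeff f (k + 2) * z ^ (k + 2)) = z * (eval_fps ?F z - 1)"
    by (simp only: sums_iff)
  then show ?thesis by (simp only: L_op_def) (simp add: algebra_simps)
qed

lemma L_quotient_ode:
  assumes hol: "f holomorphic_on unit_disc" and z: "z \<in> unit_disc" and \<sigma>: "\<sigma> > real n"
  shows "z * eval_fps (fps_deriv (L_quotient_fps n \<sigma> f)) z = of_real (\<sigma> - real n) *
    (eval_fps (L_quotient_fps (Suc n) \<sigma> f) z - eval_fps (L_quotient_fps n \<sigma> f) z)"
proof -
  let ?F = "L_quotient_fps n \<sigma> f" and ?G = "L_quotient_fps (Suc n) \<sigma> f"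
  have F: "ereal (norm z) < fps_conv_radius ?F" and G: "ereal (norm z) < fps_conv_radius ?G"
    using \<sigma> by (auto intro!: in_conv_radius_L_quotient hol z)
  have F': "ereal (norm z) < fps_conv_radius (fps_deriv ?F)"
    using F fps_conv_radius_deriv[of ?F] by (rule less_le_trans)
  have diff: "ereal (norm z) < fps_conv_radius (?G - ?F)"
    using F G fps_conv_radius_diff[of ?G ?F] by (meson less_le_trans min_less_iff_conj)
  have "z * eval_fps (fps_deriv ?F) z = eval_fps (fps_X * fps_deriv ?F) z"
    using F' by (simp add: eval_fps_mult)
  also have "\<dots> = eval_fps (fps_const (of_real (\<sigma> - real n)) * (?G - ?F)) z"
    using fps_X_deriv_L_quotient[OF \<sigma>] by simp
  also have "\<dots> = of_real (\<sigma> - real n) * eval_fps (?G - ?F) z"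
    using diff by (subst eval_fps_mult) auto
  also have "eval_fps (?G - ?F) z = eval_fps ?G z - eval_fps ?F z"
    using F G by (rule eval_fps_diff[rotated])
  finally show ?thesis .
qed

section \<open>The inclusion\<close>

theorem theorem3:
  fixes n :: nat and \<sigma> :: real
  assumes "\<sigma> \<ge> real n + 2"
  shows "class_S (n + 1) \<sigma> \<subseteq> class_S n \<sigma>"
proof
  fix f assume f: "f \<in> class_S (n + 1) \<sigma>"
  then have A: "f \<in> class_A" unfolding class_S_def by blast
  then have hol: "f holomorphic_on unit_disc" unfolding class_A_def by blast
  define e where "e m = eval_fps (L_quotient_fps m \<sigma> f)" for m
  have e0: "e m 0 = 1" if "m \<le> n + 2" for m
    using that assms L_quotient_fps_nth_0[of m \<sigma> f] by (simp add: e_def eval_fps_at_0)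
  have L: "L_op m \<sigma> f z = z * e m z" if "m \<le> n + 2" "z \<in> unit_disc" for m z
    using that assms L_op_eq_eval_L_quotient[OF hol, of z m \<sigma>] by (simp add: e_def)
  have ratio: "(if z = 0 then 1 else L_op (m + 1) \<sigma> f z / L_op m \<sigma> f z) = e (m + 1) z / e m z"
    if "m \<le> n + 1" "z \<in> unit_disc" for m z
    using that by (simp add: e0 L)
  define c where "c = \<sigma> - real n - 1"
  have c: "c \<ge> 1" "\<sigma> - real n = c + 1" "\<sigma> - real (n + 1) = c"
    using assms by (simp_all add: c_def)
  have "Re (e (n + 1) z / e n z) > c / (c + 1)" if z: "z \<in> unit_disc" for z
  proof (rule ratio_in_half_plane[where R = 1
        and u = "e n" and v = "e (n + 1)" and w = "e (n + 2)"
        and u' = "eval_fps (fps_deriv (L_quotient_fps n \<sigma> f))"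
        and v' = "eval_fps (fps_deriv (L_quotient_fps (n + 1) \<sigma> f))"])
    fix z :: complex assume z: "z \<in> unit_disc"
    show "(e n has_field_derivative eval_fps (fps_deriv (L_quotient_fps n \<sigma> f)) z) (at z)"
      unfolding e_def using assms
      by (intro has_field_derivative_eval_fps in_conv_radius_L_quotient hol z) auto
    show "(e (n + 1) has_field_derivative eval_fps (fps_deriv (L_quotient_fps (n + 1) \<sigma> f)) z) (at z)"
      unfolding e_def using assms
      by (intro has_field_derivative_eval_fps in_conv_radius_L_quotient hol z) auto
    show "z * eval_fps (fps_deriv (L_quotient_fps n \<sigma> f)) z = of_real (c + 1) * (e (n + 1) z - e n z)"
      using L_quotient_ode[OF hol z, of n \<sigma>] assms c by (simp add: e_def)
    show "z * eval_fps (fps_deriv (L_quotient_fps (n + 1) \<sigma> f)) z = of_real c * (e (n + 2) z - e (n + 1) z)"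
      using L_quotient_ode[OF hol z, where n = "n + 1" and \<sigma> = \<sigma>, unfolded c(3)] assms
      by (simp add: e_def)
    have "Re (if z = 0 then 1 else L_op (n + 1 + 1) \<sigma> f z / L_op (n + 1) \<sigma> f z)
        > (\<sigma> - (real (n + 1) + 1)) / (\<sigma> - real (n + 1))"
      using f z unfolding class_S_def by blast
    then have "Re (e (n + 1 + 1) z / e (n + 1) z) > (\<sigma> - (real (n + 1) + 1)) / (\<sigma> - real (n + 1))"
      by (simp only: ratio[OF order_refl z])
    moreover have "(\<sigma> - (real (n + 1) + 1)) / (\<sigma> - real (n + 1)) = (c - 1) / c"
      by (simp add: c_def algebra_simps)
    ultimately show "(c - 1) / c < Re (e (n + 2) z / e (n + 1) z)" by simp
  qed (use c z e0 in auto)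
  moreover have "(\<sigma> - (real n + 1)) / (\<sigma> - real n) = c / (c + 1)"
    by (simp add: c_def algebra_simps)
  ultimately have "Re (if z = 0 then 1 else L_op (n + 1) \<sigma> f z / L_op n \<sigma> f z)
      > (\<sigma> - (real n + 1)) / (\<sigma> - real n)" if "z \<in> unit_disc" for z
    using that by (simp only: ratio[OF le_add1 that])
  then show "f \<in> class_S n \<sigma>" using A unfolding class_S_def by blast
qed

end
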